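(* The nonzero elements among $C_0,C_1,\ldots,C_n$ form a basis of a subalgebra of the group algebra $\mathbb{Q}[G_{r,n}]$ (the colored Eulerian descent algebra), and this subalgebra is contained in the Mantaci-Reutenauer algebra.
   Context: Let $r,n\ge 1$. Write $i_c$ for a letter $i$ with color $c\in\{0,1,\ldots,r-1\}$, and order colored letters by color first and then by value: $i_c<j_d$ iff $c<d$, or $c=d$ and $i<j$. The group $G_{r,n}$ of $r$-colored permutations is the group of all bijections $\pi$ of $\{i_c:1\le i\le n,\ 0\le c\le r-1\}$ such that $\pi(i_0)=k_l$ implies $\pi(i_a)=k_{l+a}$ for all $a$ (colors modulo $r$), under composition. Such $\pi$ is identified with the word $\pi(1)\cdots\pi(n)$ where $\pi(i):=\pi(i_0)$; if $\tau(i)=j_k$ and $\sigma(j)=l_p$ then $(\sigma\tau)(i)=l_{k+p}$, color taken mod $r$. The descent number $\mathrm{des}(\pi)$ is the number of $i\in\{1,\ldots,n\}$ with $\pi(i)>\pi(i+1)$, where $\pi(n+1):=0_1$ (so $n$ is a descent iff the color of $\pi(n)$ is nonzero). Put $C_i=\sum_{\pi\in G_{r,n},\ \mathrm{des}(\pi)=i}\pi$. The Mantaci-Reutenauer algebra is the linear span in $\mathbb{Q}[G_{r,n}]$ of the sums of the classes of the following equivalence relation: $\pi$ and $\sigma$ are equivalent if they have the same associated colored composition, i.e. for every $i$ the letters $\pi(i)$ and $\sigma(i)$ have the same color, and each maximal run of consecutive equally colored letters has the same set of descent positions in $\pi$ as in $\sigma$. *)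

theory Defs
  imports
    Complex_Main
    "HOL-Algebra.Group"
    "HOL-Combinatorics.Permutations"
    "HOL-Library.Poly_Mapping"
begin

section \<open>The group algebra over the rationals\<close>

text \<open>
  An element of the group algebra of \<open>G\<close> is a finitely supported function
  from group elements to \<open>rat\<close> whose support lies in \<open>carrier G\<close>. The multiplication that
  \<open>Poly_Mapping\<close> itself provides is convolution over an additive monoid and is not used here.
\<close>

abbreviation qscale :: "rat \<Rightarrow> ('a \<Rightarrow>\<^sub>0 rat) \<Rightarrow> ('a \<Rightarrow>\<^sub>0 rat)"
  where "qscale q \<equiv> Poly_Mapping.map ((*) q)"

lemma lookup_qscale: "Poly_Mapping.lookup (qscale q a) x = q * Poly_Mapping.lookup a x"
  by (simp add: Poly_Mapping.map.rep_eq when_def)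

global_interpretation QG: vector_space "qscale :: rat \<Rightarrow> ('a \<Rightarrow>\<^sub>0 rat) \<Rightarrow> ('a \<Rightarrow>\<^sub>0 rat)"
  by standard
    (auto intro!: poly_mapping_eqI simp: lookup_qscale lookup_add algebra_simps)

definition ga_carrier :: "('a, 'm) monoid_scheme \<Rightarrow> ('a \<Rightarrow>\<^sub>0 rat) set"
  where "ga_carrier G = {a. Poly_Mapping.keys a \<subseteq> carrier G}"

definition ga_mult ::
    "('a, 'm) monoid_scheme \<Rightarrow> ('a \<Rightarrow>\<^sub>0 rat) \<Rightarrow> ('a \<Rightarrow>\<^sub>0 rat) \<Rightarrow> ('a \<Rightarrow>\<^sub>0 rat)"
  where "ga_mult G a b =
    (\<Sum>x\<in>Poly_Mapping.keys a. \<Sum>y\<in>Poly_Mapping.keys b.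
      Poly_Mapping.single (x \<otimes>\<^bsub>G\<^esub> y) (Poly_Mapping.lookup a x * Poly_Mapping.lookup b y))"

definition ga_one :: "('a, 'm) monoid_scheme \<Rightarrow> ('a \<Rightarrow>\<^sub>0 rat)"
  where "ga_one G = Poly_Mapping.single \<one>\<^bsub>G\<^esub> 1"

definition ga_subalgebra :: "('a, 'm) monoid_scheme \<Rightarrow> ('a \<Rightarrow>\<^sub>0 rat) set \<Rightarrow> bool"
  where "ga_subalgebra G A \<longleftrightarrow>
    A \<subseteq> ga_carrier G \<and> QG.subspace A \<and> ga_one G \<in> A \<and>
    (\<forall>a\<in>A. \<forall>b\<in>A. ga_mult G a b \<in> A)"

definition ga_sum :: "'a set \<Rightarrow> ('a \<Rightarrow>\<^sub>0 rat)"
  where "ga_sum S = (\<Sum>x\<in>S. Poly_Mapping.single x 1)"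


section \<open>Colored permutations\<close>

text \<open>The letter \<open>i\<close> with color \<open>c\<close> is the pair \<open>(i, c)\<close>; it is compared by color first.\<close>

type_synonym letter = "nat \<times> nat"

definition letter_less :: "letter \<Rightarrow> letter \<Rightarrow> bool"  (infix "\<prec>" 50)
  where "x \<prec> y \<longleftrightarrow> snd x < snd y \<or> snd x = snd y \<and> fst x < fst y"

definition letters :: "nat \<Rightarrow> nat \<Rightarrow> letter set"
  where "letters r n = {1..n} \<times> {0..<r}"

text \<open>
  A bijection of \<open>letters r n\<close> is represented by its extension by the identity, so
  that distinct functions represent distinct bijections.
\<close>

definition colored_perms :: "nat \<Rightarrow> nat \<Rightarrow> (letter \<Rightarrow> letter) set"
  where "colored_perms r n = {\<pi>. \<pi> permutes letters r n \<and>
    (\<forall>i\<in>{1..n}. \<forall>k l. \<pi> (i, 0) = (k, l) \<longrightarrow>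
      (\<forall>a\<in>{0..<r}. \<pi> (i, a) = (k, (l + a) mod r)))}"

definition colored_perm_group :: "nat \<Rightarrow> nat \<Rightarrow> (letter \<Rightarrow> letter) monoid"
  where "colored_perm_group r n = \<lparr>carrier = colored_perms r n, monoid.mult = (\<circ>), one = id\<rparr>"

lemma finite_colored_perms: "finite (colored_perms r n)"
  by (rule finite_subset[OF _ finite_permutations[of "letters r n"]])
    (auto simp: colored_perms_def letters_def)

lemma group_colored_perm_group:
  assumes "r \<ge> 1"
  shows "group (colored_perm_group r n)"
proof (rule groupI; unfold colored_perm_group_def; simp)
  show "id \<in> colored_perms r n"
    by (auto simp: colored_perms_def permutes_id)
next
  fix \<sigma> \<tau> assume \<sigma>: "\<sigma> \<in> colored_perms r n" and \<tau>: "\<tau> \<in> colored_perms r n"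
  have "(\<sigma> \<circ> \<tau>) (i, a) = (k, (l + a) mod r)"
    if i: "i \<in> {1..n}" and a: "a \<in> {0..<r}" and kl: "(\<sigma> \<circ> \<tau>) (i, 0) = (k, l)" for i a k l
  proof -
    obtain j c where j: "\<tau> (i, 0) = (j, c)" by fastforce
    have "(i, 0) \<in> letters r n" using i assms by (auto simp: letters_def)
    then have jc: "j \<in> {1..n}" "c \<in> {0..<r}"
      using \<tau> j permutes_in_image[of \<tau> "letters r n" "(i, 0)"]
      by (auto simp: colored_perms_def letters_def)
    obtain p q where p: "\<sigma> (j, 0) = (p, q)" by fastforce
    have \<sigma>j: "\<sigma> (j, b) = (p, (q + b) mod r)" if "b \<in> {0..<r}" for b
      using \<sigma> jc(1) p that by (auto simp: colored_perms_def)
    have \<tau>i: "\<tau> (i, a) = (j, (c + a) mod r)"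
      using \<tau> i j a by (auto simp: colored_perms_def)
    have "k = p" "l = (q + c) mod r" using kl j \<sigma>j[OF jc(2)] by auto
    then show ?thesis using \<tau>i \<sigma>j[of "(c + a) mod r"] assms
      by (simp add: mod_simps add.assoc)
  qed
  then show "\<sigma> \<circ> \<tau> \<in> colored_perms r n"
    using \<sigma> \<tau> by (auto simp: colored_perms_def intro: permutes_compose)
next
  fix \<sigma> assume \<sigma>: "\<sigma> \<in> colored_perms r n"
  then have perm: "\<sigma> permutes letters r n" by (simp add: colored_perms_def)
  have "inv_into UNIV \<sigma> (i, a) = (k, (l + a) mod r)"
    if i: "i \<in> {1..n}" and a: "a \<in> {0..<r}" and kl: "inv_into UNIV \<sigma> (i, 0) = (k, l)" for i a k l
  proof -
    have \<sigma>kl: "\<sigma> (k, l) = (i, 0)" using kl perm by (metis permutes_inverses(1))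
    have "(i, 0) \<in> letters r n" using i assms by (auto simp: letters_def)
    then have k: "k \<in> {1..n}" and l: "l \<in> {0..<r}"
      using kl permutes_in_image[OF permutes_inv[OF perm], of "(i, 0)"]
      by (auto simp: letters_def)
    obtain p q where p: "\<sigma> (k, 0) = (p, q)" by fastforce
    have \<sigma>k: "\<sigma> (k, b) = (p, (q + b) mod r)" if "b \<in> {0..<r}" for b
      using \<sigma> k p that by (auto simp: colored_perms_def)
    have pq: "p = i" "(q + l) mod r = 0" using \<sigma>k[OF l] \<sigma>kl by auto
    have "(q + (l + a) mod r) mod r = ((q + l) mod r + a) mod r"
      by (simp add: mod_simps add.assoc)
    then have "\<sigma> (k, (l + a) mod r) = (i, a)"
      using \<sigma>k[of "(l + a) mod r"] assms pq a by simp
    then show ?thesis using perm by (metis permutes_inverses(2))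
  qed
  then have "inv_into UNIV \<sigma> \<in> colored_perms r n"
    using perm by (auto simp: colored_perms_def intro: permutes_inv)
  moreover have "inv_into UNIV \<sigma> \<circ> \<sigma> = id" using perm by (rule permutes_inv_o)
  ultimately show "\<exists>\<tau>\<in>colored_perms r n. \<tau> \<circ> \<sigma> = id" by blast
qed (auto simp: o_assoc)


section \<open>Descents\<close>

text \<open>The word of \<open>\<pi>\<close>, followed by the letter \<open>0\<close> with color \<open>1\<close> in position \<open>n + 1\<close>.\<close>

definition word :: "nat \<Rightarrow> (letter \<Rightarrow> letter) \<Rightarrow> nat \<Rightarrow> letter"
  where "word n \<pi> i = (if i = n + 1 then (0, 1) else \<pi> (i, 0))"

definition des :: "nat \<Rightarrow> (letter \<Rightarrow> letter) \<Rightarrow> nat"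
  where "des n \<pi> = card {i \<in> {1..n}. word n \<pi> (i + 1) \<prec> word n \<pi> i}"

definition des_sum :: "nat \<Rightarrow> nat \<Rightarrow> nat \<Rightarrow> ((letter \<Rightarrow> letter) \<Rightarrow>\<^sub>0 rat)"
  where "des_sum r n i = ga_sum {\<pi> \<in> colored_perms r n. des n \<pi> = i}"


section \<open>The Mantaci-Reutenauer algebra\<close>

definition color :: "(letter \<Rightarrow> letter) \<Rightarrow> nat \<Rightarrow> nat"
  where "color \<pi> i = snd (\<pi> (i, 0))"

text \<open>Positions \<open>a, \<dots>, b\<close> form a maximal run of equally colored letters of \<open>\<pi>\<close>.\<close>

definition color_run :: "nat \<Rightarrow> (letter \<Rightarrow> letter) \<Rightarrow> nat \<Rightarrow> nat \<Rightarrow> bool"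
  where "color_run n \<pi> a b \<longleftrightarrow> 1 \<le> a \<and> a \<le> b \<and> b \<le> n \<and>
    (\<forall>i\<in>{a..b}. color \<pi> i = color \<pi> a) \<and>
    (a = 1 \<or> color \<pi> (a - 1) \<noteq> color \<pi> a) \<and>
    (b = n \<or> color \<pi> (b + 1) \<noteq> color \<pi> b)"

definition run_descents :: "(letter \<Rightarrow> letter) \<Rightarrow> nat \<Rightarrow> nat \<Rightarrow> nat set"
  where "run_descents \<pi> a b = {i \<in> {a..<b}. \<pi> (i + 1, 0) \<prec> \<pi> (i, 0)}"

definition same_colored_composition ::
    "nat \<Rightarrow> nat \<Rightarrow> ((letter \<Rightarrow> letter) \<times> (letter \<Rightarrow> letter)) set"
  where "same_colored_composition r n =
    {(\<pi>, \<sigma>). \<pi> \<in> colored_perms r n \<and> \<sigma> \<in> colored_perms r n \<and>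
      (\<forall>i\<in>{1..n}. color \<pi> i = color \<sigma> i) \<and>
      (\<forall>a b. color_run n \<pi> a b \<longrightarrow> run_descents \<pi> a b = run_descents \<sigma> a b)}"

definition mantaci_reutenauer :: "nat \<Rightarrow> nat \<Rightarrow> ((letter \<Rightarrow> letter) \<Rightarrow>\<^sub>0 rat) set"
  where "mantaci_reutenauer r n =
    QG.span (ga_sum ` (colored_perms r n // same_colored_composition r n))"

lemma equiv_same_colored_composition:
  "equiv (colored_perms r n) (same_colored_composition r n)"
proof (rule equivI)
  have runs: "color_run n \<pi> a b \<longleftrightarrow> color_run n \<sigma> a b"
    if "\<forall>i\<in>{1..n}. color \<pi> i = color \<sigma> i" for \<pi> \<sigma> a b
  proof -
    have "color_run n \<sigma> a b" if "color_run n \<pi> a b"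
      and eq: "\<And>i. 1 \<le> i \<Longrightarrow> i \<le> n \<Longrightarrow> color \<pi> i = color \<sigma> i" for \<pi> \<sigma>
    proof -
      have ab: "1 \<le> a" "a \<le> b" "b \<le> n" using that(1) by (auto simp: color_run_def)
      have "a = 1 \<or> color \<pi> (a - 1) = color \<sigma> (a - 1)" using ab by (cases "a = 1") (auto intro: eq)
      moreover have "b = n \<or> color \<pi> (b + 1) = color \<sigma> (b + 1)"
        using ab by (cases "b = n") (auto intro: eq)
      moreover have "\<forall>i\<in>{a..b}. color \<pi> i = color \<sigma> i" using ab by (auto intro: eq)
      ultimately show ?thesis using that(1) ab unfolding color_run_def
        by (metis atLeastAtMost_iff order_refl)
    qed
    from this[of \<pi> \<sigma>] this[of \<sigma> \<pi>] show ?thesis using that by auto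
  qed
  show "same_colored_composition r n \<subseteq> colored_perms r n \<times> colored_perms r n"
    by (auto simp: same_colored_composition_def)
  show "refl_on (colored_perms r n) (same_colored_composition r n)"
    by (auto simp: same_colored_composition_def refl_on_def)
  show "sym (same_colored_composition r n)"
  proof (rule symI)
    fix \<pi> \<sigma> assume "(\<pi>, \<sigma>) \<in> same_colored_composition r n"
    then show "(\<sigma>, \<pi>) \<in> same_colored_composition r n"
      using runs[of \<pi> \<sigma>] unfolding same_colored_composition_def by auto
  qed
  show "trans (same_colored_composition r n)"
  proof (rule transI)
    fix \<pi> \<sigma> \<tau>
    assume "(\<pi>, \<sigma>) \<in> same_colored_composition r n" "(\<sigma>, \<tau>) \<in> same_colored_composition r n"
    then show "(\<pi>, \<tau>) \<in> same_colored_composition r n"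
      using runs[of \<pi> \<sigma>] unfolding same_colored_composition_def by auto
  qed
qed

end

theory Submission
  imports Defs "HOL-Library.Product_Lexorder"
begin

text \<open>
  A function \<open>f\<close> from \<open>{1..n}\<close> to \<open>{0..r k}\<close> is standardized to the colored permutation whose word
  lists the letters \<open>a\<close>, colored \<open>f a mod r\<close>, in the order of the pairs \<open>(f a, a)\<close>; let \<open>F\<^sub>k\<close> be the
  sum of all these standardizations. Composing two standardizations is a radix sort, which gives
  \<open>F\<^sub>k F\<^sub>l = F\<^sub>m\<close> with \<open>r m + 1 = (r k + 1) (r l + 1)\<close>. The quotients \<open>f a div r\<close>, read along the word
  of \<open>\<pi>\<close>, form a weakly increasing sequence bounded by \<open>k\<close> that has
  to increase strictly at the descents of \<open>\<pi>\<close>, so the coefficient of \<open>\<pi>\<close> in \<open>F\<^sub>k\<close> depends only on \<open>k - des \<pi>\<close>; it is \<open>1\<close> if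
  \<open>des \<pi> = k\<close> and \<open>0\<close> if \<open>des \<pi> > k\<close>. By triangularity the \<open>F\<^sub>k\<close> and the \<open>C\<^sub>i\<close> have the same span.
\<close>

section \<open>Stable sorting\<close>

text \<open>Positions are counted from 1, and equal keys are ordered by the letters themselves. This
  makes the sort stable and the order of the pairs total.\<close>

definition key_rank :: "nat \<Rightarrow> (nat \<Rightarrow> nat) \<Rightarrow> nat \<Rightarrow> nat"
  where "key_rank n f a = card {b \<in> {1..n}. (f b, b) \<le> (f a, a)}"

definition key_unrank :: "nat \<Rightarrow> (nat \<Rightarrow> nat) \<Rightarrow> nat \<Rightarrow> nat"
  where "key_unrank n f = inv_into {1..n} (key_rank n f)"

lemma key_rank_less_iff:
  assumes "a \<in> {1..n}" and "b \<in> {1..n}"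
  shows "key_rank n f a < key_rank n f b \<longleftrightarrow> (f a, a) < (f b, b)"
proof
  assume "(f a, a) < (f b, b)"
  then have "{c \<in> {1..n}. (f c, c) \<le> (f a, a)} \<subseteq> {c \<in> {1..n}. (f c, c) \<le> (f b, b)}"
    and "\<not> (f b, b) \<le> (f a, a)"
    using less_imp_le order_trans by (blast, simp only: not_le)
  then have "{c \<in> {1..n}. (f c, c) \<le> (f a, a)} \<subset> {c \<in> {1..n}. (f c, c) \<le> (f b, b)}"
    using assms(2) by blast
  then show "key_rank n f a < key_rank n f b"
    unfolding key_rank_def by (intro psubset_card_mono) auto
next
  assume less: "key_rank n f a < key_rank n f b"
  show "(f a, a) < (f b, b)"
  proof (rule ccontr)
    assume "\<not> ?thesis"
    then have "(f b, b) \<le> (f a, a)" by (simp only: not_less)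
    then have "{c \<in> {1..n}. (f c, c) \<le> (f b, b)} \<subseteq> {c \<in> {1..n}. (f c, c) \<le> (f a, a)}"
      using order_trans by blast
    then have "key_rank n f b \<le> key_rank n f a"
      unfolding key_rank_def by (intro card_mono) auto
    with less show False by simp
  qed
qed

lemma bij_betw_key_rank: "bij_betw (key_rank n f) {1..n} {1..n}"
proof -
  have "inj_on (key_rank n f) {1..n}"
  proof (rule inj_onI)
    fix a b assume ab: "a \<in> {1..n}" "b \<in> {1..n}" "key_rank n f a = key_rank n f b"
    then have "\<not> (f a, a) < (f b, b)" "\<not> (f b, b) < (f a, a)"
      using key_rank_less_iff[of a n b f] key_rank_less_iff[of b n a f] by auto
    then show "a = b" by auto
  qed
  moreover have "key_rank n f ` {1..n} \<subseteq> {1..n}"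
  proof
    fix s assume "s \<in> key_rank n f ` {1..n}"
    then obtain a where a: "a \<in> {1..n}" "s = card {b \<in> {1..n}. (f b, b) \<le> (f a, a)}"
      by (auto simp: key_rank_def)
    have "s \<le> card {1..n}" unfolding a(2) by (rule card_mono) auto
    moreover have "s \<noteq> 0" using a by auto
    ultimately show "s \<in> {1..n}" by simp
  qed
  ultimately show ?thesis using endo_inj_surj[of "{1..n}"] by (simp add: bij_betw_def)
qed

lemma bij_betw_key_unrank: "bij_betw (key_unrank n f) {1..n} {1..n}"
  unfolding key_unrank_def by (rule bij_betw_inv_into[OF bij_betw_key_rank])

lemma key_unrank_in: "s \<in> {1..n} \<Longrightarrow> key_unrank n f s \<in> {1..n}"
  using bij_betw_key_unrank by (rule bij_betwE[THEN bspec])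

lemma key_rank_in: "s \<in> {1..n} \<Longrightarrow> key_rank n f s \<in> {1..n}"
  using bij_betw_key_rank by (rule bij_betwE[THEN bspec])

lemma key_rank_unrank: "s \<in> {1..n} \<Longrightarrow> key_rank n f (key_unrank n f s) = s"
  unfolding key_unrank_def by (rule bij_betw_inv_into_right[OF bij_betw_key_rank])

lemma key_unrank_rank: "a \<in> {1..n} \<Longrightarrow> key_unrank n f (key_rank n f a) = a"
  unfolding key_unrank_def by (rule bij_betw_inv_into_left[OF bij_betw_key_rank])

lemma key_unrank_less_iff:
  assumes "s \<in> {1..n}" and "t \<in> {1..n}"
  shows "(f (key_unrank n f s), key_unrank n f s) < (f (key_unrank n f t), key_unrank n f t)
    \<longleftrightarrow> s < t"
  using key_rank_less_iff[OF key_unrank_in key_unrank_in, OF assms, of f f f] assms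
  by (simp only: key_rank_unrank)

text \<open>A finite linear order has only one increasing enumeration: the elements whose pair is at
  most that of \<open>p s\<close> are exactly \<open>p 1\<close>, ..., \<open>p s\<close>, so
  \<open>p s\<close> has rank \<open>s\<close>. Increase is demanded between neighbours only, since
  descents of a word compare neighbours only.\<close>

lemma key_unrank_unique:
  assumes p: "bij_betw p {1..n} {1..n}"
    and inc: "\<And>s. s \<in> {1..<n} \<Longrightarrow> (f (p s), p s) < (f (p (Suc s)), p (Suc s))"
    and s: "s \<in> {1..n}"
  shows "p s = key_unrank n f s"
proof -
  have mono: "(f (p u), p u) < (f (p t), p t)" if "u < t" "1 \<le> u" "t \<le> n" for u t
    using that
  proof (induction t)
    case (Suc t)
    have step: "(f (p t), p t) < (f (p (Suc t)), p (Suc t))" using Suc.prems by (intro inc) auto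
    show ?case
    proof (cases "u = t")
      case False
      then have "(f (p u), p u) < (f (p t), p t)" using Suc.prems by (intro Suc.IH) auto
      then show ?thesis using step by (rule less_trans)
    qed (use step in simp)
  qed simp
  have le_iff: "(f (p u), p u) \<le> (f (p s), p s) \<longleftrightarrow> u \<le> s" if "u \<in> {1..n}" for u
  proof (cases u s rule: linorder_cases)
    case less
    then have "(f (p u), p u) < (f (p s), p s)" using that s by (intro mono) auto
    then show ?thesis using less by (simp only: less_imp_le)
  next
    case greater
    then have "(f (p s), p s) < (f (p u), p u)" using that s by (intro mono) auto
    then show ?thesis using greater by (simp only: not_le[symmetric])
  qed simp
  have "{b \<in> {1..n}. (f b, b) \<le> (f (p s), p s)} = p ` {1..s}"
  proof (intro equalityI subsetI)
    fix b assume b: "b \<in> {b \<in> {1..n}. (f b, b) \<le> (f (p s), p s)}"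
    then have "b \<in> p ` {1..n}" using bij_betw_imp_surj_on[OF p] by simp
    then obtain u where u: "u \<in> {1..n}" "b = p u" by blast
    then have "u \<le> s" using b le_iff by blast
    then show "b \<in> p ` {1..s}" using u by auto
  next
    fix b assume "b \<in> p ` {1..s}"
    then obtain u where u: "u \<in> {1..s}" "b = p u" by auto
    then have un: "u \<in> {1..n}" using s by auto
    have "p u \<in> {1..n}" using p un by (rule bij_betwE[THEN bspec])
    then show "b \<in> {b \<in> {1..n}. (f b, b) \<le> (f (p s), p s)}" using u le_iff[OF un] by simp
  qed
  moreover have "card (p ` {1..s}) = s"
    using p s by (subst card_image) (auto simp: bij_betw_def intro: inj_on_subset)
  ultimately have "key_rank n f (p s) = s" by (simp only: key_rank_def)
  moreover have "p s \<in> {1..n}" using p s by (rule bij_betwE[THEN bspec])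
  ultimately show ?thesis using key_unrank_rank by metis
qed


section \<open>Standardization\<close>

lemma colored_perms_permutes: "\<pi> \<in> colored_perms r n \<Longrightarrow> \<pi> permutes letters r n"
  by (simp add: colored_perms_def)

lemma colored_permsD:
  assumes "\<pi> \<in> colored_perms r n" and "i \<in> {1..n}" and "a < r"
  shows "\<pi> (i, a) = (fst (\<pi> (i, 0)), (color \<pi> i + a) mod r)"
proof -
  have "\<forall>k l. \<pi> (i, 0) = (k, l) \<longrightarrow> (\<forall>a\<in>{0..<r}. \<pi> (i, a) = (k, (l + a) mod r))"
    using assms(1,2) unfolding colored_perms_def by blast
  then show ?thesis using assms(3) unfolding color_def by (metis atLeastLessThan_iff le0 prod.collapse)
qed

lemma colored_perms_letter:
  assumes "r \<ge> 1" and "\<pi> \<in> colored_perms r n" and "i \<in> {1..n}"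
  shows "fst (\<pi> (i, 0)) \<in> {1..n}" and "color \<pi> i < r"
proof -
  have "\<pi> (i, 0) \<in> letters r n"
    using assms permutes_in_image[OF colored_perms_permutes[OF assms(2)]]
    by (simp add: letters_def)
  then show "fst (\<pi> (i, 0)) \<in> {1..n}" "color \<pi> i < r"
    by (auto simp: letters_def color_def mem_Times_iff)
qed

lemma colored_perms_eqI:
  assumes "\<pi> \<in> colored_perms r n" and "\<sigma> \<in> colored_perms r n"
    and "\<And>i. i \<in> {1..n} \<Longrightarrow> \<pi> (i, 0) = \<sigma> (i, 0)"
  shows "\<pi> = \<sigma>"
proof
  fix x :: letter
  obtain i a where x: "x = (i, a)" by fastforce
  show "\<pi> x = \<sigma> x"
  proof (cases "x \<in> letters r n")
    case True
    then have ia: "i \<in> {1..n}" "a < r" by (auto simp: x letters_def)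
    show ?thesis
      unfolding x colored_permsD[OF assms(1) ia] colored_permsD[OF assms(2) ia]
      by (simp only: color_def assms(3)[OF ia(1)])
  next
    case False
    then show ?thesis using assms(1,2) by (simp add: colored_perms_permutes[THEN permutes_not_in])
  qed
qed

text \<open>If positions \<open>i\<close> and \<open>j\<close> carried the same value, then adding a
  suitable color to the argument \<open>(i, 0)\<close> would give it the image of
  \<open>(j, 0)\<close>, against injectivity of \<open>\<pi>\<close> on colored letters.\<close>

lemma bij_betw_colored_perm:
  assumes "r \<ge> 1" and "\<pi> \<in> colored_perms r n"
  shows "bij_betw (\<lambda>i. fst (\<pi> (i, 0))) {1..n} {1..n}"
proof -
  have "inj_on (\<lambda>i. fst (\<pi> (i, 0))) {1..n}"
  proof (rule inj_onI)
    fix i j assume i: "i \<in> {1..n}" and j: "j \<in> {1..n}"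
      and eq: "fst (\<pi> (i, 0)) = fst (\<pi> (j, 0))"
    \<comment> \<open>The difference of the two colors modulo \<open>r\<close>, arranged so that the
      subtraction does not truncate.\<close>
    define a where "a = (r - color \<pi> i + color \<pi> j) mod r"
    have "color \<pi> i < r" "color \<pi> j < r" by (rule colored_perms_letter(2)[OF assms], fact)+
    then have "(color \<pi> i + a) mod r = color \<pi> j"
      by (simp add: a_def mod_add_right_eq)
    moreover have "a < r" using assms by (simp add: a_def)
    ultimately have "\<pi> (i, a) = \<pi> (j, 0)"
      using colored_permsD[OF assms(2) i, of a] eq by (metis color_def prod.collapse)
    moreover have "inj \<pi>" using assms(2) by (rule colored_perms_permutes[THEN permutes_inj])
    ultimately show "i = j" by (simp add: inj_eq)
  qed
  moreover have "(\<lambda>i. fst (\<pi> (i, 0))) ` {1..n} \<subseteq> {1..n}"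
    using assms colored_perms_letter by blast
  ultimately show ?thesis using endo_inj_surj[of "{1..n}"] by (simp add: bij_betw_def)
qed

text \<open>The colors \<open>c\<close> need not lie below \<open>r\<close>, so that a key function
  can be passed on unreduced. Outside the letters the map is the identity, as the representation of
  colored permutations requires.\<close>

definition colored_perm_of :: "nat \<Rightarrow> nat \<Rightarrow> (nat \<Rightarrow> nat) \<Rightarrow> (nat \<Rightarrow> nat) \<Rightarrow> letter \<Rightarrow> letter"
  where "colored_perm_of r n p c =
    (\<lambda>(i, a). if (i, a) \<in> letters r n then (p i, (c i + a) mod r) else (i, a))"

lemma colored_perm_of_apply:
  "i \<in> {1..n} \<Longrightarrow> a < r \<Longrightarrow> colored_perm_of r n p c (i, a) = (p i, (c i + a) mod r)"
  by (simp add: colored_perm_of_def letters_def)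

lemma colored_perm_of_in:
  assumes r: "r \<ge> 1" and p: "bij_betw p {1..n} {1..n}"
  shows "colored_perm_of r n p c \<in> colored_perms r n"
proof -
  let ?\<pi> = "colored_perm_of r n p c"
  have "inj_on ?\<pi> (letters r n)"
  proof (rule inj_onI)
    fix x y assume xy: "x \<in> letters r n" "y \<in> letters r n" "?\<pi> x = ?\<pi> y"
    obtain i a j b where ij: "x = (i, a)" "y = (j, b)" by fastforce
    have *: "i \<in> {1..n}" "j \<in> {1..n}" "a < r" "b < r" using xy by (auto simp: ij letters_def)
    then have eq: "p i = p j" "(c i + a) mod r = (c j + b) mod r"
      using xy(3) by (auto simp: ij colored_perm_of_apply)
    have "i = j" by (rule inj_onD[OF bij_betw_imp_inj_on[OF p] eq(1) *(1,2)])
    moreover have "a mod r = b mod r"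
    proof -
      \<comment> \<open>Adding \<open>(r - 1) * c i\<close> completes \<open>c i\<close> to a
        multiple of \<open>r\<close>, which cancels it without a subtraction.\<close>
      have "(c i + a + (r - 1) * c i) mod r = (c i + b + (r - 1) * c i) mod r"
        by (rule mod_add_cong) (use eq(2) \<open>i = j\<close> in simp_all)
      moreover have "c i + x + (r - 1) * c i = x + r * c i" for x
        using r by (cases r) auto
      ultimately show ?thesis by (simp only: mod_mult_self2)
    qed
    ultimately show "x = y" using * by (simp add: ij)
  qed
  moreover have "?\<pi> ` letters r n \<subseteq> letters r n"
  proof (rule image_subsetI)
    fix x assume x: "x \<in> letters r n"
    obtain i a where ia: "x = (i, a)" by fastforce
    have "i \<in> {1..n}" "a < r" using x by (auto simp: ia letters_def)
    moreover from this have "p i \<in> {1..n}" using p by (auto dest: bij_betwE)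
    ultimately show "?\<pi> x \<in> letters r n"
      using r by (simp add: ia colored_perm_of_apply) (simp add: letters_def)
  qed
  ultimately have "bij_betw ?\<pi> (letters r n) (letters r n)"
    using endo_inj_surj[of "letters r n"] by (simp add: bij_betw_def letters_def)
  then have "?\<pi> permutes letters r n"
    by (rule bij_imp_permutes) (auto simp: colored_perm_of_def)
  then show ?thesis
    using r by (auto simp: colored_perms_def colored_perm_of_apply mod_simps)
qed

definition standardization :: "nat \<Rightarrow> nat \<Rightarrow> (nat \<Rightarrow> nat) \<Rightarrow> letter \<Rightarrow> letter"
  where "standardization r n f =
    colored_perm_of r n (key_unrank n f) (\<lambda>s. f (key_unrank n f s))"

lemma standardization_in: "r \<ge> 1 \<Longrightarrow> standardization r n f \<in> colored_perms r n"
  unfolding standardization_def by (rule colored_perm_of_in[OF _ bij_betw_key_unrank])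

lemma standardization_apply:
  "s \<in> {1..n} \<Longrightarrow> a < r \<Longrightarrow> standardization r n f (s, a) =
    (key_unrank n f s, (f (key_unrank n f s) + a) mod r)"
  by (simp add: standardization_def colored_perm_of_apply)

text \<open>This is the test by which standardizations are recognized below. Right to left, the
  increasing pairs identify the values of the word through \<open>key_unrank_unique\<close>, and the
  residues of \<open>f\<close> then identify its colors.\<close>

lemma standardization_eq_iff:
  assumes r: "r \<ge> 1" and \<pi>: "\<pi> \<in> colored_perms r n"
  shows "standardization r n f = \<pi> \<longleftrightarrow>
    (\<forall>s\<in>{1..n}. color \<pi> s = f (fst (\<pi> (s, 0))) mod r) \<and>
    (\<forall>s\<in>{1..<n}. (f (fst (\<pi> (s, 0))), fst (\<pi> (s, 0)))
      < (f (fst (\<pi> (Suc s, 0))), fst (\<pi> (Suc s, 0))))" (is "_ \<longleftrightarrow> ?C \<and> ?I")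
proof
  assume eq: "standardization r n f = \<pi>"
  have app: "\<pi> (s, 0) = (key_unrank n f s, f (key_unrank n f s) mod r)" if "s \<in> {1..n}" for s
    using standardization_apply[OF that, of 0 r f] r unfolding eq by simp
  then have ?C by (simp add: color_def)
  moreover have ?I
  proof
    fix s assume s: "s \<in> {1..<n}"
    then have "s \<in> {1..n}" "Suc s \<in> {1..n}" by auto
    then show "(f (fst (\<pi> (s, 0))), fst (\<pi> (s, 0)))
      < (f (fst (\<pi> (Suc s, 0))), fst (\<pi> (Suc s, 0)))"
      using key_unrank_less_iff[of s n "Suc s" f] by (simp only: app fst_conv lessI)
  qed
  ultimately show "?C \<and> ?I" ..
next
  assume CI: "?C \<and> ?I"
  have "fst (\<pi> (s, 0)) = key_unrank n f s" if "s \<in> {1..n}" for s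
    by (rule key_unrank_unique[OF bij_betw_colored_perm[OF r \<pi>] _ that]) (use CI in blast)
  then show "standardization r n f = \<pi>"
    using CI r by (intro colored_perms_eqI[OF standardization_in[OF r] \<pi>])
      (auto simp: standardization_apply prod_eq_iff color_def)
qed

text \<open>
  Radix sort: sorting by \<open>f\<close> and then stably by \<open>g\<close> is sorting by the two-digit numbers with leading
  digit \<open>g\<close>. As the base is \<open>1\<close> modulo \<open>r\<close>, the colors add up correctly.
\<close>

lemma standardization_comp:
  assumes r: "r \<ge> 1" and f: "\<And>a. a \<in> {1..n} \<Longrightarrow> f a \<le> r * k"
    and h: "\<And>a. a \<in> {1..n} \<Longrightarrow> h a = (r * k + 1) * g (key_rank n f a) + f a"
  shows "standardization r n f \<circ> standardization r n g = standardization r n h"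
proof -
  let ?p = "key_unrank n f" and ?q = "key_unrank n g"
  let ?\<pi> = "standardization r n f \<circ> standardization r n g"
  have \<pi>: "?\<pi> \<in> colored_perms r n"
    using group.is_monoid[OF group_colored_perm_group[OF r], of n]
      standardization_in[OF r, of n f] standardization_in[OF r, of n g]
    unfolding colored_perm_group_def monoid_def by simp
  have app: "?\<pi> (s, 0) = (?p (?q s), (f (?p (?q s)) + g (?q s)) mod r)" if "s \<in> {1..n}" for s
    using that r key_unrank_in[OF that, of g] by (simp add: standardization_apply mod_simps)
  have hp: "h (?p t) = (r * k + 1) * g t + f (?p t)" if "t \<in> {1..n}" for t
    using h[OF key_unrank_in[OF that, of f]] by (simp only: key_rank_unrank[OF that])
  have "standardization r n h = ?\<pi>"
  proof (subst standardization_eq_iff[OF r \<pi>], intro conjI ballI)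
    fix s assume s: "s \<in> {1..n}"
    have "(r * k + 1) * g (?q s) + f (?p (?q s)) = (f (?p (?q s)) + g (?q s)) + r * (k * g (?q s))"
      by (simp add: algebra_simps)
    then have "((r * k + 1) * g (?q s) + f (?p (?q s))) mod r = (f (?p (?q s)) + g (?q s)) mod r"
      by (simp only: mod_mult_self2)
    then show "color ?\<pi> s = h (fst (?\<pi> (s, 0))) mod r"
      using app[OF s] hp[OF key_unrank_in[OF s]] by (simp only: color_def fst_conv snd_conv)
  next
    fix s assume "s \<in> {1..<n}"
    then have s: "s \<in> {1..n}" "Suc s \<in> {1..n}" by auto
    define t u where "t = ?q s" and "u = ?q (Suc s)"
    have tu: "t \<in> {1..n}" "u \<in> {1..n}" unfolding t_def u_def by (intro key_unrank_in s)+
    have "(g t, t) < (g u, u)"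
      using key_unrank_less_iff[OF s, of g] by (simp only: t_def u_def)
    then have "g t < g u \<or> g t = g u \<and> t < u" by auto
    \<comment> \<open>The low digit is at most \<open>r * k\<close>, hence below the base, so a
      larger leading digit decides.\<close>
    moreover have "(h (?p t), ?p t) < (h (?p u), ?p u)" if "g t < g u"
    proof -
      have "h (?p t) < (r * k + 1) * (g t + 1)"
        using f[OF key_unrank_in[OF tu(1), of f]] by (simp add: hp[OF tu(1)])
      also have "\<dots> \<le> (r * k + 1) * g u" using that by (intro mult_le_mono) auto
      also have "\<dots> \<le> h (?p u)" by (simp add: hp[OF tu(2)])
      finally show ?thesis by simp
    qed
    \<comment> \<open>With equal leading digits stability matters: \<open>t < u\<close> says that
      \<open>?p t\<close> comes before \<open>?p u\<close> in the sort by \<open>f\<close>.\<close>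
    moreover have "(h (?p t), ?p t) < (h (?p u), ?p u)" if "g t = g u" "t < u"
      using key_unrank_less_iff[OF tu, of f] that by (simp add: hp[OF tu(1)] hp[OF tu(2)])
    ultimately have "(h (?p t), ?p t) < (h (?p u), ?p u)"
      by blast
    then show "(h (fst (?\<pi> (s, 0))), fst (?\<pi> (s, 0)))
      < (h (fst (?\<pi> (Suc s, 0))), fst (?\<pi> (Suc s, 0)))"
      using app[OF s(1)] app[OF s(2)] by (simp only: fst_conv t_def u_def)
  qed
  then show ?thesis ..
qed


section \<open>Barred sequences\<close>

text \<open>The extra entry at \<open>Suc n\<close> is fixed to \<open>m\<close>, so that the upper
  bound is one more step of the sequence and can be made strict by \<open>n \<in> D\<close>.
  Functions are extensional so that each sequence is counted once.\<close>

definition barred_seqs :: "nat \<Rightarrow> nat set \<Rightarrow> nat \<Rightarrow> (nat \<Rightarrow> nat) set"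
  where "barred_seqs n D m = {i \<in> {1..Suc n} \<rightarrow>\<^sub>E UNIV. i (Suc n) = m \<and>
    (\<forall>s\<in>{1..n}. i s + of_bool (s \<in> D) \<le> i (Suc s))}"

lemma barred_seqs_step:
  "i \<in> barred_seqs n D m \<Longrightarrow> 1 \<le> s \<Longrightarrow> s \<le> n \<Longrightarrow> i s + of_bool (s \<in> D) \<le> i (Suc s)"
  by (simp add: barred_seqs_def)

lemma card_Int_less_Suc:
  "1 \<le> s \<Longrightarrow> card (D \<inter> {1..<Suc s}) = card (D \<inter> {1..<s}) + of_bool (s \<in> D)"
  by (simp add: atLeastLessThanSuc Int_insert_right)

text \<open>Each element of \<open>D\<close> passed on the way to \<open>s\<close> forces an
  increase by at least one. This makes the truncated subtraction in \<open>card_barred_seqs\<close>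
  exact.\<close>

lemma barred_seqs_ge:
  assumes i: "i \<in> barred_seqs n D m" and "1 \<le> s" and "s \<le> Suc n"
  shows "card (D \<inter> {1..<s}) \<le> i s"
  using assms(2,3)
proof (induction s rule: dec_induct)
  case (step s)
  then show ?case using barred_seqs_step[OF i, of s] card_Int_less_Suc[of s D] by simp
qed simp

text \<open>Subtracting from entry \<open>s\<close> the number of elements of \<open>D\<close>
  before \<open>s\<close> turns the strict steps into weak ones and lowers the last entry by
  \<open>card D\<close>. Hence \<open>D\<close> enters the count only through its size.\<close>

lemma card_barred_seqs:
  assumes D: "D \<subseteq> {1..n}"
  shows "card (barred_seqs n D m) =
    (if card D \<le> m then card (barred_seqs n {} (m - card D)) else 0)"
proof -
  define d where "d s = card (D \<inter> {1..<s})" for s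
  have dD: "d (Suc n) = card D"
    using D by (auto simp: d_def atLeastLessThanSuc_atLeastAtMost intro: arg_cong[where f = card])
  have dS: "d (Suc s) = d s + of_bool (s \<in> D)" if "1 \<le> s" for s
    using card_Int_less_Suc[OF that] by (simp only: d_def)
  have ge: "d s \<le> i s" if "i \<in> barred_seqs n D m" "s \<in> {1..Suc n}" for i s
    using barred_seqs_ge[OF that(1)] that(2) by (simp add: d_def)
  have last: "i (Suc n) = m" if "i \<in> barred_seqs n E m" for i E m
    using that by (simp add: barred_seqs_def)
  have ext: "i \<in> extensional {1..Suc n}" if "i \<in> barred_seqs n E m" for i E m
    using that by (simp add: barred_seqs_def PiE_def)
  show ?thesis
  proof (cases "card D \<le> m")
    case True
    let ?\<phi> = "\<lambda>i. \<lambda>s\<in>{1..Suc n}. i s - d s" and ?\<psi> = "\<lambda>i. \<lambda>s\<in>{1..Suc n}. i s + d s"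
    have "bij_betw ?\<phi> (barred_seqs n D m) (barred_seqs n {} (m - card D))"
    proof (rule bij_betw_byWitness[where f' = ?\<psi>])
      show "\<forall>i\<in>barred_seqs n D m. ?\<psi> (?\<phi> i) = i"
      proof
        fix i assume i: "i \<in> barred_seqs n D m"
        show "?\<psi> (?\<phi> i) = i"
          by (rule extensionalityI[OF _ ext[OF i]]) (use ge[OF i] in simp_all)
      qed
      show "\<forall>i\<in>barred_seqs n {} (m - card D). ?\<phi> (?\<psi> i) = i"
      proof
        fix i assume i: "i \<in> barred_seqs n {} (m - card D)"
        show "?\<phi> (?\<psi> i) = i"
          by (rule extensionalityI[OF _ ext[OF i]]) simp_all
      qed
      show "?\<phi> ` barred_seqs n D m \<subseteq> barred_seqs n {} (m - card D)"
      proof (rule image_subsetI)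
        fix i assume i: "i \<in> barred_seqs n D m"
        have "i s - d s \<le> i (Suc s) - d (Suc s)" if "1 \<le> s" "s \<le> n" for s
          using barred_seqs_step[OF i that] dS[OF that(1)] ge[OF i, of s] that by simp
        then show "?\<phi> i \<in> barred_seqs n {} (m - card D)"
          using last[OF i] dD by (simp add: barred_seqs_def)
      qed
      show "?\<psi> ` barred_seqs n {} (m - card D) \<subseteq> barred_seqs n D m"
      proof (rule image_subsetI)
        fix i assume i: "i \<in> barred_seqs n {} (m - card D)"
        have "i s + d s + of_bool (s \<in> D) \<le> i (Suc s) + d (Suc s)" if "1 \<le> s" "s \<le> n" for s
          using barred_seqs_step[OF i that] dS[OF that(1)] by simp
        then show "?\<psi> i \<in> barred_seqs n D m"
          using last[OF i] dD True by (simp add: barred_seqs_def)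
      qed
    qed
    then show ?thesis using True by (simp add: bij_betw_same_card)
  next
    case False
    have "i \<notin> barred_seqs n D m" for i
      using ge[of i "Suc n"] last[of i D m] dD False by auto
    then have "barred_seqs n D m = {}" by blast
    then show ?thesis using False by simp
  qed
qed

text \<open>A weakly increasing sequence of natural numbers ending in 0 is constant. The value 1
  becomes the diagonal entry of the triangular system relating \<open>std_sum\<close> to
  \<open>des_sum\<close>.\<close>

lemma card_barred_seqs_0: "card (barred_seqs n {} 0) = 1"
proof -
  have "barred_seqs n {} 0 = {\<lambda>s\<in>{1..Suc n}. 0}"
  proof (intro equalityI subsetI)
    fix i assume i: "i \<in> barred_seqs n {} 0"
    have "i s = 0" if "s \<in> {1..Suc n}" for s
    proof -
      have "s \<le> Suc n" using that by simp
      then have "1 \<le> s \<longrightarrow> i s = 0"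
      proof (induction rule: inc_induct)
        case base
        then show ?case using i by (simp add: barred_seqs_def)
      next
        case (step s)
        then show ?case using barred_seqs_step[OF i, of s] by auto
      qed
      then show ?thesis using that by simp
    qed
    moreover have "i \<in> extensional {1..Suc n}" using i by (simp add: barred_seqs_def PiE_def)
    ultimately show "i \<in> {\<lambda>s\<in>{1..Suc n}. 0}"
      by (auto intro: extensionalityI)
  qed (simp add: barred_seqs_def)
  then show ?thesis by simp
qed

section \<open>Descents and quotients of keys\<close>

text \<open>The quotients \<open>i\<close> and \<open>j\<close> decide when they differ. When they
  agree, the residues and then the values are compared, which is the letter order; so agreement is
  allowed exactly when there is no descent.\<close>

lemma key_less_iff:
  fixes a b c d i j r :: nat
  assumes "c < r" and "d < r" and "(a, c) \<noteq> (b, d)"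
  shows "(r * i + c, a) < (r * j + d, b) \<longleftrightarrow> i + of_bool ((b, d) \<prec> (a, c)) \<le> j"
proof (cases i j rule: linorder_cases)
  case less
  then have "r * Suc i \<le> r * j" by (intro mult_le_mono) auto
  then have "r * i + c < r * j + d" using assms(1) by simp
  then show ?thesis using less by simp
next
  case equal
  then show ?thesis using assms(3) by (auto simp: letter_less_def)
next
  case greater
  then have "r * Suc j \<le> r * i" by (intro mult_le_mono) auto
  then have "r * j + d < r * i + c" using assms(2) by simp
  then show ?thesis using greater by simp
qed

text \<open>For \<open>i = k\<close> the bound forces \<open>c = 0\<close>. As
  \<open>1 \<le> a\<close>, a nonzero color \<open>c\<close> is the same as a descent towards the
  letter 0 of color 1, so the convention for position \<open>n + 1\<close> matches the bound
  \<open>r * k\<close> on the keys.\<close>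

lemma last_key_le_iff:
  fixes a c i k r :: nat
  assumes "c < r" and "1 \<le> a"
  shows "r * i + c \<le> r * k \<longleftrightarrow> i + of_bool ((0, 1) \<prec> (a, c)) \<le> k"
proof (cases i k rule: linorder_cases)
  case less
  then have "r * Suc i \<le> r * k" by (intro mult_le_mono) auto
  then have "r * i + c \<le> r * k" using assms(1) by simp
  then show ?thesis using less by simp
next
  case equal
  then show ?thesis using assms by (auto simp: letter_less_def)
next
  case greater
  then have "r * Suc k \<le> r * i" by (intro mult_le_mono) auto
  then have "r * k < r * i + c" using assms(1) by simp
  then show ?thesis using greater by simp
qed

definition descents :: "nat \<Rightarrow> (letter \<Rightarrow> letter) \<Rightarrow> nat set"
  where "descents n \<pi> = {s \<in> {1..n}. word n \<pi> (s + 1) \<prec> word n \<pi> s}"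

text \<open>Here \<open>i\<close> lists the quotients of the keys along the word. Steps before
  position \<open>n\<close> are translated by \<open>key_less_iff\<close>, and the step at
  \<open>n\<close> becomes the upper bound by \<open>last_key_le_iff\<close>.\<close>

lemma barred_iff_key_increasing:
  assumes r: "r \<ge> 1" and n: "n \<ge> 1" and \<pi>: "\<pi> \<in> colored_perms r n"
    and f: "\<And>s. s \<in> {1..n} \<Longrightarrow> f (fst (\<pi> (s, 0))) = r * i s + color \<pi> s"
    and last: "i (Suc n) = k"
  shows "(\<forall>s\<in>{1..n}. i s + of_bool (s \<in> descents n \<pi>) \<le> i (Suc s)) \<longleftrightarrow>
    (\<forall>s\<in>{1..<n}. (f (fst (\<pi> (s, 0))), fst (\<pi> (s, 0)))
      < (f (fst (\<pi> (Suc s, 0))), fst (\<pi> (Suc s, 0)))) \<and> f (fst (\<pi> (n, 0))) \<le> r * k"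
proof -
  have pair: "\<pi> (s, 0) = (fst (\<pi> (s, 0)), color \<pi> s)" for s by (simp add: color_def)
  have step: "(f (fst (\<pi> (s, 0))), fst (\<pi> (s, 0)))
      < (f (fst (\<pi> (Suc s, 0))), fst (\<pi> (Suc s, 0))) \<longleftrightarrow>
    i s + of_bool (s \<in> descents n \<pi>) \<le> i (Suc s)" if "s \<in> {1..<n}" for s
  proof -
    have s: "s \<in> {1..n}" "Suc s \<in> {1..n}" using that by auto
    \<comment> \<open>Distinctness of the two letters, needed for \<open>key_less_iff\<close>,
      already holds for their values.\<close>
    have "inj_on (\<lambda>i. fst (\<pi> (i, 0))) {1..n}"
      using bij_betw_colored_perm[OF r \<pi>] by (rule bij_betw_imp_inj_on)
    from inj_onD[OF this _ s] have "fst (\<pi> (s, 0)) \<noteq> fst (\<pi> (Suc s, 0))" by auto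
    moreover have "s \<in> descents n \<pi> \<longleftrightarrow>
      (fst (\<pi> (Suc s, 0)), color \<pi> (Suc s)) \<prec> (fst (\<pi> (s, 0)), color \<pi> s)"
      using that by (simp add: descents_def word_def pair[symmetric])
    ultimately show ?thesis
      unfolding f[OF s(1)] f[OF s(2)]
      using key_less_iff[OF colored_perms_letter(2)[OF r \<pi> s(1)] colored_perms_letter(2)[OF r \<pi> s(2)]]
      by simp
  qed
  have nn: "n \<in> {1..n}" using n by simp
  have "n \<in> descents n \<pi> \<longleftrightarrow> (0, 1) \<prec> (fst (\<pi> (n, 0)), color \<pi> n)"
    using n by (simp add: descents_def word_def pair[symmetric])
  moreover have "1 \<le> fst (\<pi> (n, 0))" using colored_perms_letter(1)[OF r \<pi> nn] by simp
  ultimately have end_step: "f (fst (\<pi> (n, 0))) \<le> r * k \<longleftrightarrow>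
    i n + of_bool (n \<in> descents n \<pi>) \<le> i (Suc n)"
    unfolding f[OF nn] last
    using last_key_le_iff[OF colored_perms_letter(2)[OF r \<pi> nn]] by simp
  have "{1..n} = insert n {1..<n}" using n by auto
  then show ?thesis using step end_step by auto
qed

text \<open>The colors of \<open>\<pi>\<close> prescribe all residues of \<open>f\<close> modulo
  \<open>r\<close>, so \<open>f\<close> is determined by its quotients. Read along the word and
  followed by \<open>k\<close>, these form a barred sequence, and every barred sequence
  arises.\<close>

lemma card_standardization_fibre:
  assumes r: "r \<ge> 1" and n: "n \<ge> 1" and \<pi>: "\<pi> \<in> colored_perms r n"
  shows "card {f \<in> {1..n} \<rightarrow>\<^sub>E {0..r * k}. standardization r n f = \<pi>} =
    card (barred_seqs n (descents n \<pi>) k)" (is "card ?F = card ?B")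
proof -
  define p q where "p s = fst (\<pi> (s, 0))" and "q = inv_into {1..n} p" for s
  have p: "bij_betw p {1..n} {1..n}"
    using bij_betw_colored_perm[OF r \<pi>] by (simp add: p_def[abs_def])
  have p_in: "p s \<in> {1..n}" if "s \<in> {1..n}" for s using p that by (rule bij_betwE[THEN bspec])
  have q_in: "q s \<in> {1..n}" if "s \<in> {1..n}" for s
    using bij_betw_inv_into[OF p] that unfolding q_def by (rule bij_betwE[THEN bspec])
  have pq: "p (q a) = a" if "a \<in> {1..n}" for a
    unfolding q_def by (rule bij_betw_inv_into_right[OF p that])
  have qp: "q (p s) = s" if "s \<in> {1..n}" for s
    unfolding q_def by (rule bij_betw_inv_into_left[OF p that])
  have col: "color \<pi> s < r" if "s \<in> {1..n}" for s using colored_perms_letter(2)[OF r \<pi> that] .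
  \<comment> \<open>\<open>?\<phi>\<close> rebuilds the keys from quotients and colors, with
    \<open>q\<close> leading from a value to its position; \<open>?\<psi>\<close> reads off the
    quotients and appends \<open>k\<close> in position \<open>Suc n\<close>.\<close>
  let ?\<phi> = "\<lambda>i. \<lambda>a\<in>{1..n}. r * i (q a) + color \<pi> (q a)"
  let ?\<psi> = "\<lambda>f. \<lambda>s\<in>{1..Suc n}. if s = Suc n then k else f (p s) div r"
  note std = standardization_eq_iff[OF r \<pi>, folded p_def]
  note inc = barred_iff_key_increasing[OF r n \<pi>, folded p_def]
  have \<phi>p: "?\<phi> i (p s) = r * i s + color \<pi> s" if "s \<in> {1..n}" for i s
    using that p_in[OF that] by (simp add: qp)
  have F_col: "color \<pi> s = f (p s) mod r" if "f \<in> ?F" "s \<in> {1..n}" for f s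
    using that std[of f] by blast
  have "bij_betw ?\<phi> ?B ?F"
  proof (rule bij_betw_byWitness[where f' = ?\<psi>])
    show "\<forall>i\<in>?B. ?\<psi> (?\<phi> i) = i"
    proof
      fix i assume i: "i \<in> ?B"
      show "?\<psi> (?\<phi> i) = i"
      proof (rule extensionalityI[of _ "{1..Suc n}"])
        fix s assume s: "s \<in> {1..Suc n}"
        show "?\<psi> (?\<phi> i) s = i s"
        proof (cases "s = Suc n")
          case False
          then have "s \<in> {1..n}" using s by simp
          from \<phi>p[OF this, of i] col[OF this] show ?thesis using s False by simp
        qed (use i in \<open>simp add: barred_seqs_def\<close>)
      qed (use i in \<open>simp_all add: barred_seqs_def PiE_def\<close>)
    qed
    show "\<forall>f\<in>?F. ?\<phi> (?\<psi> f) = f"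
    proof
      fix f assume f: "f \<in> ?F"
      show "?\<phi> (?\<psi> f) = f"
      proof (rule extensionalityI[of _ "{1..n}"])
        fix a assume a: "a \<in> {1..n}"
        then show "?\<phi> (?\<psi> f) a = f a"
          using q_in[OF a] F_col[OF f q_in[OF a]] pq[OF a] by simp
      qed (use f in \<open>simp_all add: PiE_def\<close>)
    qed
    show "?\<phi> ` ?B \<subseteq> ?F"
    proof (rule image_subsetI)
      fix i assume i: "i \<in> ?B"
      have I: "(\<forall>s\<in>{1..<n}. (?\<phi> i (p s), p s) < (?\<phi> i (p (Suc s)), p (Suc s)))"
        and le: "?\<phi> i (p n) \<le> r * k"
        using inc[of "?\<phi> i" i k, OF \<phi>p] i by (auto simp: barred_seqs_def simp del: restrict_apply)
      \<comment> \<open>Only the last key is bounded so far; since the keys increase weakly along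
        the word, the bound passes to the earlier positions by downward induction.\<close>
      have "?\<phi> i (p s) \<le> r * k" if "1 \<le> s" "s \<le> n" for s
        using that(2,1)
      proof (induction rule: inc_induct)
        case (step s)
        have "(?\<phi> i (p s), p s) < (?\<phi> i (p (Suc s)), p (Suc s))"
          using step I by (simp del: restrict_apply less_prod_simp)
        then have "?\<phi> i (p s) \<le> ?\<phi> i (p (Suc s))"
          by (auto simp del: restrict_apply)
        then show ?case using step by (simp del: restrict_apply)
      qed (use le in simp)
      then have "?\<phi> i a \<le> r * k" if "a \<in> {1..n}" for a
        using q_in[OF that] pq[OF that] by (metis atLeastAtMost_iff)
      moreover have "standardization r n (?\<phi> i) = \<pi>"
        using I \<phi>p col by (simp add: std del: restrict_apply)
      ultimately show "?\<phi> i \<in> ?F" by auto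
    qed
    show "?\<psi> ` ?F \<subseteq> ?B"
    proof (rule image_subsetI)
      fix f assume f: "f \<in> ?F"
      have "f (p s) = r * ?\<psi> f s + color \<pi> s" if "s \<in> {1..n}" for s
        using that F_col[OF f that] by simp
      moreover have "f (p n) \<le> r * k" using f p_in[of n] n by (auto simp: PiE_def Pi_def)
      moreover have "\<forall>s\<in>{1..<n}. (f (p s), p s) < (f (p (Suc s)), p (Suc s))"
        using f std[of f] by blast
      ultimately have "\<forall>s\<in>{1..n}. ?\<psi> f s + of_bool (s \<in> descents n \<pi>) \<le> ?\<psi> f (Suc s)"
        using inc[of f "?\<psi> f" k] by simp
      then show "?\<psi> f \<in> ?B" by (simp add: barred_seqs_def)
    qed
  qed
  then show ?thesis by (simp add: bij_betw_same_card)
qed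


section \<open>Bilinearity in the group algebra\<close>

text \<open>The supports in the definition of the product vary with the arguments, which hinders
  linearity. Terms outside them vanish, so several products can be written over common finite index
  sets.\<close>

lemma ga_mult_superset:
  assumes "finite S" and "Poly_Mapping.keys a \<subseteq> S" and "finite T" and "Poly_Mapping.keys b \<subseteq> T"
  shows "ga_mult G a b = (\<Sum>x\<in>S. \<Sum>y\<in>T.
    Poly_Mapping.single (x \<otimes>\<^bsub>G\<^esub> y) (Poly_Mapping.lookup a x * Poly_Mapping.lookup b y))"
proof -
  have "(\<Sum>y\<in>Poly_Mapping.keys b. Poly_Mapping.single (x \<otimes>\<^bsub>G\<^esub> y)
        (Poly_Mapping.lookup a x * Poly_Mapping.lookup b y)) =
      (\<Sum>y\<in>T. Poly_Mapping.single (x \<otimes>\<^bsub>G\<^esub> y)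
        (Poly_Mapping.lookup a x * Poly_Mapping.lookup b y))" for x
    using assms by (intro sum.mono_neutral_left) (auto simp: in_keys_iff)
  then show ?thesis
    unfolding ga_mult_def using assms
    by (simp only:) (intro sum.mono_neutral_left, auto simp: in_keys_iff)
qed

lemma ga_mult_add_left: "ga_mult G (a + b) c = ga_mult G a c + ga_mult G b c"
  using keys_add[of a b]
  by (subst (1 2 3) ga_mult_superset[where S = "Poly_Mapping.keys a \<union> Poly_Mapping.keys b"
        and T = "Poly_Mapping.keys c"])
    (auto simp: lookup_add distrib_right single_add sum.distrib)

lemma ga_mult_add_right: "ga_mult G a (b + c) = ga_mult G a b + ga_mult G a c"
  using keys_add[of b c]
  by (subst (1 2 3) ga_mult_superset[where S = "Poly_Mapping.keys a"
        and T = "Poly_Mapping.keys b \<union> Poly_Mapping.keys c"])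
    (auto simp: lookup_add distrib_left single_add sum.distrib)

lemma ga_mult_0_left [simp]: "ga_mult G 0 b = 0"
  by (simp add: ga_mult_def)

lemma ga_mult_0_right [simp]: "ga_mult G a 0 = 0"
  by (simp add: ga_mult_def)

lemma keys_qscale: "Poly_Mapping.keys (qscale q a) \<subseteq> Poly_Mapping.keys a"
  by (auto simp: in_keys_iff lookup_qscale)

lemma qscale_single: "qscale q (Poly_Mapping.single x v) = Poly_Mapping.single x (q * v)"
  by (rule poly_mapping_eqI) (simp add: lookup_qscale lookup_single when_def)

lemma ga_mult_qscale_left: "ga_mult G (qscale q a) b = qscale q (ga_mult G a b)"
  by (subst (1 2) ga_mult_superset[where S = "Poly_Mapping.keys a" and T = "Poly_Mapping.keys b"])
    (auto simp: keys_qscale lookup_qscale QG.scale_sum_right qscale_single mult.assoc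
      dest: subsetD[OF keys_qscale])

lemma ga_mult_qscale_right: "ga_mult G a (qscale q b) = qscale q (ga_mult G a b)"
  by (subst (1 2) ga_mult_superset[where S = "Poly_Mapping.keys a" and T = "Poly_Mapping.keys b"])
    (auto simp: keys_qscale lookup_qscale QG.scale_sum_right qscale_single mult.left_commute
      dest: subsetD[OF keys_qscale])

lemma ga_mult_sum_left: "ga_mult G (\<Sum>i\<in>I. a i) b = (\<Sum>i\<in>I. ga_mult G (a i) b)"
  by (induction I rule: infinite_finite_induct) (simp_all add: ga_mult_add_left)

lemma ga_mult_sum_right: "ga_mult G a (\<Sum>i\<in>I. b i) = (\<Sum>i\<in>I. ga_mult G a (b i))"
  by (induction I rule: infinite_finite_induct) (simp_all add: ga_mult_add_right)

lemma ga_mult_single: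
  "ga_mult G (Poly_Mapping.single x u) (Poly_Mapping.single y v) =
    Poly_Mapping.single (x \<otimes>\<^bsub>G\<^esub> y) (u * v)"
  by (simp add: ga_mult_def)

text \<open>By bilinearity, closure only has to be checked on generators; there is one span
  induction for each factor.\<close>

lemma ga_mult_span_closed:
  assumes "\<And>a b. a \<in> B \<Longrightarrow> b \<in> B \<Longrightarrow> ga_mult G a b \<in> QG.span B"
    and a: "a \<in> QG.span B" and b: "b \<in> QG.span B"
  shows "ga_mult G a b \<in> QG.span B"
  using a
proof (induction rule: QG.span_induct)
  case base
  show ?case
    by (auto simp: QG.subspace_def ga_mult_add_left ga_mult_qscale_left
        intro: QG.span_zero QG.span_add QG.span_scale)
next
  case (step x)
  show ?case using b
  proof (induction rule: QG.span_induct)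
    case base
    show ?case
      by (auto simp: QG.subspace_def ga_mult_add_right ga_mult_qscale_right
          intro: QG.span_zero QG.span_add QG.span_scale)
  next
    case (step y)
    then show ?case using \<open>x \<in> B\<close> by (rule assms(1)[rotated])
  qed
qed

section \<open>Sums over disjoint sets of group elements\<close>

lemma lookup_ga_sum:
  "finite S \<Longrightarrow> Poly_Mapping.lookup (ga_sum S) x = of_bool (x \<in> S)"
  by (simp add: ga_sum_def lookup_sum lookup_single when_def)

lemma ga_sum_Union_disjoint:
  assumes "\<And>S. S \<in> \<C> \<Longrightarrow> finite S" and "disjoint \<C>"
  shows "ga_sum (\<Union>\<C>) = (\<Sum>S\<in>\<C>. ga_sum S)"
  using sum.Union_disjoint[of \<C> "\<lambda>x. Poly_Mapping.single x (1::rat)"] assms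
  by (auto simp: ga_sum_def disjoint_def)

lemma inj_on_ga_sum_disjoint:
  assumes "\<And>i. i \<in> I \<Longrightarrow> finite (S i) \<and> S i \<noteq> {}" and "disjoint_family_on S I"
  shows "inj_on (\<lambda>i. ga_sum (S i)) I"
proof (rule inj_onI, rule ccontr)
  fix i j assume ij: "i \<in> I" "j \<in> I" "ga_sum (S i) = ga_sum (S j)" "i \<noteq> j"
  obtain x where x: "x \<in> S i" using assms(1) ij(1) by blast
  have "x \<in> S j"
    using ij assms(1) x lookup_ga_sum[of "S i" x] lookup_ga_sum[of "S j" x]
    by (metis of_bool_eq_1_iff)
  then show False using x assms(2) ij by (auto simp: disjoint_family_on_def)
qed

text \<open>An element \<open>x\<close> of \<open>S j\<close> lies in no other member of the family,
  so the coefficient at \<open>x\<close> of a linear combination is the scalar belonging to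
  \<open>S j\<close>.\<close>

lemma independent_ga_sum_disjoint:
  assumes "\<And>i. i \<in> I \<Longrightarrow> finite (S i) \<and> S i \<noteq> {}" and disj: "disjoint_family_on S I"
    and "finite I"
  shows "QG.independent ((\<lambda>i. ga_sum (S i)) ` I)"
proof -
  have "u (ga_sum (S j)) = 0"
    if sum: "(\<Sum>v\<in>(\<lambda>i. ga_sum (S i)) ` I. qscale (u v) v) = 0" and j: "j \<in> I" for u j
  proof -
    obtain x where x: "x \<in> S j" using assms(1) j by blast
    have "x \<in> S i \<longleftrightarrow> i = j" if "i \<in> I" for i
      using that x j disj by (auto simp: disjoint_family_on_def)
    then have "(\<Sum>i\<in>I. u (ga_sum (S i)) * Poly_Mapping.lookup (ga_sum (S i)) x) =
        (\<Sum>i\<in>I. if i = j then u (ga_sum (S i)) else 0)"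
      using assms(1) by (intro sum.cong) (auto simp: lookup_ga_sum)
    also have "\<dots> = u (ga_sum (S j))" using \<open>finite I\<close> j by simp
    finally have "(\<Sum>i\<in>I. u (ga_sum (S i)) * Poly_Mapping.lookup (ga_sum (S i)) x) =
      u (ga_sum (S j))" .
    moreover have "Poly_Mapping.lookup (\<Sum>i\<in>I. qscale (u (ga_sum (S i))) (ga_sum (S i))) x = 0"
      using sum by (simp add: sum.reindex[OF inj_on_ga_sum_disjoint[OF assms(1) disj]])
    ultimately show ?thesis by (simp add: lookup_sum lookup_qscale)
  qed
  then show ?thesis
    using \<open>finite I\<close> by (intro QG.independent_if_scalars_zero) auto
qed


section \<open>The colored Eulerian descent algebra\<close>

text \<open>This is \<open>F\<^sub>k\<close> from the introduction. It runs over functions, so a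
  colored permutation is counted once for every function that standardizes to it.\<close>

definition std_sum :: "nat \<Rightarrow> nat \<Rightarrow> nat \<Rightarrow> ((letter \<Rightarrow> letter) \<Rightarrow>\<^sub>0 rat)"
  where "std_sum r n k =
    (\<Sum>f\<in>{1..n} \<rightarrow>\<^sub>E {0..r * k}. Poly_Mapping.single (standardization r n f) 1)"

text \<open>By \<open>standardization_comp\<close>, each pair of functions \<open>f\<close>,
  \<open>g\<close> contributes the standardization of a two-digit function. With low digits up to
  \<open>r * k\<close> and leading digits up to \<open>r * l\<close>, these functions take values in
  an initial interval of the natural numbers, and each function into that interval arises exactly
  once.\<close>

lemma ga_mult_std_sum:
  assumes r: "r \<ge> 1"
  shows "ga_mult (colored_perm_group r n) (std_sum r n k) (std_sum r n l) =
    std_sum r n (r * k * l + k + l)"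
proof -
  define N where "N = r * k + 1"
  let ?F = "\<lambda>k. {1..n} \<rightarrow>\<^sub>E {0..r * k}"
  \<comment> \<open>The digit \<open>f\<close> is indexed by letters but \<open>g\<close> by
    positions after sorting by \<open>f\<close>. Therefore \<open>?i\<close> first recovers
    \<open>f\<close> as the remainder and then uses its \<open>key_unrank\<close> to reindex the
    quotient.\<close>
  let ?j = "\<lambda>(f, g). \<lambda>a\<in>{1..n}. N * g (key_rank n f a) + f a"
  let ?f = "\<lambda>h. \<lambda>a\<in>{1..n}. h a mod N"
  let ?i = "\<lambda>h. (?f h, \<lambda>t\<in>{1..n}. h (key_unrank n (?f h) t) div N)"
  \<comment> \<open>The right-hand side is the largest two-digit number with leading digit
    \<open>r * l\<close> and low digit \<open>r * k\<close>.\<close>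
  have bound: "r * (r * k * l + k + l) = N * (r * l) + r * k"
    by (simp add: N_def algebra_simps)
  have "ga_mult (colored_perm_group r n) (std_sum r n k) (std_sum r n l) =
    (\<Sum>f\<in>?F k. \<Sum>g\<in>?F l.
      Poly_Mapping.single (standardization r n f \<circ> standardization r n g) 1)"
    by (simp only: std_sum_def ga_mult_sum_left)
      (simp add: ga_mult_sum_right ga_mult_single colored_perm_group_def)
  also have "\<dots> = (\<Sum>(f, g)\<in>?F k \<times> ?F l.
      Poly_Mapping.single (standardization r n f \<circ> standardization r n g) 1)"
    by (simp add: sum.cartesian_product)
  also have "\<dots> = std_sum r n (r * k * l + k + l)"
    unfolding std_sum_def bound
  proof (rule sum.reindex_bij_witness[where i = ?i and j = ?j])
    fix x assume "x \<in> ?F k \<times> ?F l"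
    then obtain f g where x: "x = (f, g)" and f: "f \<in> ?F k" and g: "g \<in> ?F l" by blast
    have f_le: "f a \<le> r * k" if "a \<in> {1..n}" for a using PiE_mem[OF f that] by simp
    have g_le: "g a \<le> r * l" if "a \<in> {1..n}" for a using PiE_mem[OF g that] by simp
    have f_less: "f a < N" if "a \<in> {1..n}" for a using f_le[OF that] by (simp add: N_def)
    have ff: "?f (?j x) = f"
      by (rule extensionalityI[of _ "{1..n}"]) (use f f_less in \<open>auto simp: x PiE_def\<close>)
    have "(\<lambda>t\<in>{1..n}. ?j x (key_unrank n f t) div N) = g"
    proof (rule extensionalityI[of _ "{1..n}"])
      fix t assume t: "t \<in> {1..n}"
      show "(\<lambda>t\<in>{1..n}. ?j x (key_unrank n f t) div N) t = g t"
        using t key_unrank_in[OF t, of f] f_less[OF key_unrank_in[OF t, of f]] key_rank_unrank[OF t, of f]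
        by (simp add: x)
    qed (use g in \<open>simp_all add: PiE_def\<close>)
    then show "?i (?j x) = x" unfolding ff by (simp add: x)
    have "N * g (key_rank n f a) + f a \<le> N * (r * l) + r * k" if "a \<in> {1..n}" for a
      using f_le[OF that] g_le[OF key_rank_in[OF that]] by (intro add_mono mult_le_mono2)
    then show "?j x \<in> {1..n} \<rightarrow>\<^sub>E {0..N * (r * l) + r * k}"
      by (auto simp: x)
    show "Poly_Mapping.single (standardization r n (?j x)) 1 = (case x of (f, g) \<Rightarrow>
        Poly_Mapping.single (standardization r n f \<circ> standardization r n g) 1)"
      using standardization_comp[OF r f_le, where h = "?j x" and g = g]
      by (simp add: x N_def)
  next
    fix h assume h: "h \<in> {1..n} \<rightarrow>\<^sub>E {0..N * (r * l) + r * k}"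
    have N: "N > 0" by (simp add: N_def)
    have "h a \<le> N * (r * l) + r * k" if "a \<in> {1..n}" for a using PiE_mem[OF h that] by simp
    then have "h a < N * (r * l + 1)" if "a \<in> {1..n}" for a
      using that by (fastforce simp: N_def)
    then have div: "h a div N \<le> r * l" if "a \<in> {1..n}" for a
      using that N by (metis Suc_eq_plus1 less_Suc_eq_le less_mult_imp_div_less mult.commute)
    have mod: "h a mod N \<le> r * k" for a
      using mod_less_divisor[OF N, of "h a"] by (simp add: N_def)
    show "?i h \<in> ?F k \<times> ?F l"
      using div mod key_unrank_in by (auto simp del: atLeastAtMost_iff simp: atLeast0AtMost)
    show "?j (?i h) = h"
    proof (rule extensionalityI[of _ "{1..n}"])
      fix a assume a: "a \<in> {1..n}"
      then show "?j (?i h) a = h a"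
        using key_rank_in[OF a, of "?f h"] key_unrank_rank[OF a, of "?f h"] by simp
    qed (use h in \<open>simp_all add: PiE_def\<close>)
  qed
  finally show ?thesis .
qed

section \<open>Triangular change between the two spanning families\<close>

lemma des_eq_card_descents: "des n \<pi> = card (descents n \<pi>)"
  by (simp add: des_def descents_def)

lemma des_le: "des n \<pi> \<le> n"
proof -
  have "card (descents n \<pi>) \<le> card {1..n}" by (rule card_mono) (auto simp: descents_def)
  then show ?thesis by (simp add: des_eq_card_descents)
qed

lemma finite_des_class: "finite {\<pi> \<in> colored_perms r n. des n \<pi> = i}"
  by (rule finite_subset[OF _ finite_colored_perms]) auto

lemma lookup_des_sum:
  "Poly_Mapping.lookup (des_sum r n i) \<pi> = of_bool (\<pi> \<in> colored_perms r n \<and> des n \<pi> = i)"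
  by (simp add: des_sum_def lookup_ga_sum[OF finite_des_class])

text \<open>The coefficient of \<open>\<pi>\<close> is the size of its fibre under standardization,
  hence a number of barred sequences, and this depends on \<open>\<pi>\<close> only through
  \<open>des n \<pi>\<close>.\<close>

lemma std_sum_eq_des_sums:
  assumes r: "r \<ge> 1" and n: "n \<ge> 1"
  shows "std_sum r n k = (\<Sum>i\<in>{0..n}.
    qscale (if i \<le> k then of_nat (card (barred_seqs n {} (k - i))) else 0) (des_sum r n i))"
    (is "_ = (\<Sum>i\<in>_. qscale (?w i) _)")
proof (rule poly_mapping_eqI)
  fix \<pi> :: "letter \<Rightarrow> letter"
  let ?F = "{1..n} \<rightarrow>\<^sub>E {0..r * k}"
  have "Poly_Mapping.lookup (std_sum r n k) \<pi> =
      (\<Sum>f\<in>?F. if standardization r n f = \<pi> then 1 else 0)"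
    by (simp add: std_sum_def lookup_sum lookup_single when_def)
  also have "\<dots> = of_nat (card {f \<in> ?F. standardization r n f = \<pi>})"
    by (simp add: sum.If_cases finite_PiE Int_def conj_commute)
  also have "\<dots> = of_bool (\<pi> \<in> colored_perms r n) * ?w (des n \<pi>)"
  proof (cases "\<pi> \<in> colored_perms r n")
    case True
    have "descents n \<pi> \<subseteq> {1..n}" by (auto simp: descents_def)
    from card_barred_seqs[OF this, of k] show ?thesis
      using True card_standardization_fibre[OF r n True, of k]
      by (simp add: des_eq_card_descents)
  next
    case False
    then have "{f \<in> ?F. standardization r n f = \<pi>} = {}" using standardization_in[OF r] by blast
    then show ?thesis using False by (simp only: card.empty) simp
  qed
  \<comment> \<open>The index \<open>des n \<pi>\<close> occurs in the sum because it is at most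
    \<open>n\<close>.\<close>
  also have "\<dots> = (\<Sum>i\<in>{0..n}. if i = des n \<pi> then of_bool (\<pi> \<in> colored_perms r n) * ?w i else 0)"
    using des_le[of n \<pi>] by (subst sum.delta) auto
  also have "\<dots> = (\<Sum>i\<in>{0..n}. ?w i * of_bool (\<pi> \<in> colored_perms r n \<and> des n \<pi> = i))"
    by (intro sum.cong) auto
  also have "\<dots> = Poly_Mapping.lookup (\<Sum>i\<in>{0..n}. qscale (?w i) (des_sum r n i)) \<pi>"
    by (simp add: lookup_sum lookup_qscale lookup_des_sum)
  finally show "Poly_Mapping.lookup (std_sum r n k) \<pi> =
    Poly_Mapping.lookup (\<Sum>i\<in>{0..n}. qscale (?w i) (des_sum r n i)) \<pi>" .
qed

text \<open>Only \<open>des_sum r n j\<close> with \<open>j \<le> i\<close> enter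
  \<open>std_sum r n i\<close>, and the one with \<open>j = i\<close> has coefficient 1, so the
  triangular system is solved by strong induction.\<close>

lemma des_sum_in_span_std_sum:
  assumes r: "r \<ge> 1" and n: "n \<ge> 1" and "i \<le> n"
  shows "des_sum r n i \<in> QG.span (range (std_sum r n))"
  using \<open>i \<le> n\<close>
proof (induction i rule: less_induct)
  case (less i)
  let ?t = "\<lambda>j. qscale (if j \<le> i then of_nat (card (barred_seqs n {} (i - j))) else 0) (des_sum r n j)"
  have "std_sum r n i = ?t i + (\<Sum>j\<in>{0..n} - {i}. ?t j)"
    unfolding std_sum_eq_des_sums[OF r n] using less.prems by (subst sum.remove[of _ i]) auto
  also have "?t i = des_sum r n i" by (simp add: card_barred_seqs_0)
  finally have "des_sum r n i = std_sum r n i - (\<Sum>j\<in>{0..n} - {i}. ?t j)" by simp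
  moreover have "?t j \<in> QG.span (range (std_sum r n))" if "j \<in> {0..n} - {i}" for j
  proof (cases "j < i")
    case True
    then show ?thesis using that by (intro QG.span_scale less.IH) auto
  next
    case False
    then show ?thesis using that by (simp add: QG.span_zero)
  qed
  then have "(\<Sum>j\<in>{0..n} - {i}. ?t j) \<in> QG.span (range (std_sum r n))" by (rule QG.span_sum)
  moreover have "std_sum r n i \<in> QG.span (range (std_sum r n))" by (rule QG.span_base) simp
  ultimately show ?case by (simp only: QG.span_diff)
qed

lemma span_des_sum_eq:
  assumes r: "r \<ge> 1" and n: "n \<ge> 1"
  shows "QG.span (des_sum r n ` {i \<in> {0..n}. des_sum r n i \<noteq> 0}) =
    QG.span (range (std_sum r n))"
proof -
  let ?B = "des_sum r n ` {i \<in> {0..n}. des_sum r n i \<noteq> 0}"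
  \<comment> \<open>Removing the zero elements from the family does not change its span.\<close>
  have "des_sum r n i \<in> QG.span ?B" if "i \<in> {0..n}" for i
    using that by (cases "des_sum r n i = 0") (auto intro: QG.span_zero QG.span_base)
  then have "std_sum r n k \<in> QG.span ?B" for k
    unfolding std_sum_eq_des_sums[OF r n] by (intro QG.span_sum QG.span_scale)
  then show ?thesis
    unfolding QG.span_eq using des_sum_in_span_std_sum[OF r n] by auto
qed

text \<open>The zero function is the only one available, and it leaves the letters in order with
  color 0. This provides the unit of the subalgebra.\<close>

lemma std_sum_0:
  assumes r: "r \<ge> 1"
  shows "std_sum r n 0 = ga_one (colored_perm_group r n)"
proof -
  let ?z = "\<lambda>a\<in>{1..n}. 0 :: nat"
  have id: "id \<in> colored_perms r n" by (auto simp: colored_perms_def permutes_id)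
  have "standardization r n ?z = id"
    by (subst standardization_eq_iff[OF r id]) (auto simp: color_def)
  moreover have "{1..n} \<rightarrow>\<^sub>E {0..r * 0} = {?z}"
    by (simp add: PiE_singleton[of ?z "{1..n}", symmetric] cong: PiE_cong)
  ultimately show ?thesis by (simp add: std_sum_def ga_one_def colored_perm_group_def)
qed

lemma ga_carrier_subspace: "QG.subspace (ga_carrier G)"
  by (rule QG.subspaceI)
    (auto simp: ga_carrier_def dest!: subsetD[OF keys_add] subsetD[OF keys_qscale])

lemma std_sum_in_ga_carrier:
  assumes "r \<ge> 1"
  shows "std_sum r n k \<in> ga_carrier (colored_perm_group r n)"
  unfolding std_sum_def
  by (intro QG.subspace_sum[OF ga_carrier_subspace])
    (simp add: ga_carrier_def colored_perm_group_def standardization_in[OF assms])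

lemma ga_subalgebra_span_std_sum:
  assumes r: "r \<ge> 1"
  shows "ga_subalgebra (colored_perm_group r n) (QG.span (range (std_sum r n)))"
  unfolding ga_subalgebra_def
proof (intro conjI ballI)
  show "QG.span (range (std_sum r n)) \<subseteq> ga_carrier (colored_perm_group r n)"
    by (rule QG.span_minimal[OF _ ga_carrier_subspace]) (use std_sum_in_ga_carrier[OF r] in blast)
  show "ga_one (colored_perm_group r n) \<in> QG.span (range (std_sum r n))"
    unfolding std_sum_0[OF r, symmetric] by (rule QG.span_base) simp
next
  fix a b assume "a \<in> QG.span (range (std_sum r n))" "b \<in> QG.span (range (std_sum r n))"
  then show "ga_mult (colored_perm_group r n) a b \<in> QG.span (range (std_sum r n))"
    by (rule ga_mult_span_closed[rotated]) (auto simp: ga_mult_std_sum[OF r] intro: QG.span_base)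
qed (rule QG.subspace_span)


section \<open>Containment in the Mantaci-Reutenauer algebra\<close>

text \<open>The associated colored composition records descents only inside maximal runs, so two
  equally colored neighbours have to be placed in one. It is found by extending from
  \<open>s\<close> as far as possible in both directions.\<close>

lemma obtain_color_run:
  assumes s: "1 \<le> s" "s < n" and eq: "color \<pi> (Suc s) = color \<pi> s"
  obtains a b where "color_run n \<pi> a b" and "a \<le> s" and "s < b"
proof -
  let ?A = "\<lambda>a. 1 \<le> a \<and> a \<le> s \<and> (\<forall>i\<in>{a..s}. color \<pi> i = color \<pi> s)"
  let ?B = "\<lambda>b. s \<le> b \<and> b \<le> n \<and> (\<forall>i\<in>{s..b}. color \<pi> i = color \<pi> s)"
  define a b where "a = (LEAST a. ?A a)" and "b = (GREATEST b. ?B b)"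
  have "?A s" using s by simp
  then have a: "?A a" unfolding a_def by (rule LeastI)
  \<comment> \<open>This is where the equal color of the right neighbour enters; it later gives
    \<open>s < b\<close>.\<close>
  have B: "?B (Suc s)" using s eq by (auto simp: le_Suc_eq)
  have b: "?B b" unfolding b_def by (rule GreatestI_nat[of ?B "Suc s" n]) (use B in blast)+
  have a_least: "a \<le> x" if "?A x" for x
    unfolding a_def using that by (rule Least_le[of ?A])
  have b_greatest: "x \<le> b" if "?B x" for x
    unfolding b_def using that by (rule Greatest_le_nat[of ?B _ n]) blast
  have sb: "Suc s \<le> b" using B by (rule b_greatest)
  have a_le: "1 \<le> a" "a \<le> s" and b_le: "s \<le> b" "b \<le> n" using a b by blast+
  have a_col: "color \<pi> i = color \<pi> s" if "a \<le> i" "i \<le> s" for i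
    using a that by (meson atLeastAtMost_iff)
  have b_col: "color \<pi> i = color \<pi> s" if "s \<le> i" "i \<le> b" for i
    using b that by (meson atLeastAtMost_iff)
  have ca: "color \<pi> a = color \<pi> s" by (rule a_col[OF order_refl a_le(2)])
  have cb: "color \<pi> b = color \<pi> s" by (rule b_col[OF b_le(1) order_refl])
  have "color \<pi> (a - 1) \<noteq> color \<pi> a" if "a \<noteq> 1"
  proof
    assume eq_a: "color \<pi> (a - 1) = color \<pi> a"
    have "color \<pi> i = color \<pi> s" if "i \<in> {a - 1..s}" for i
    proof (cases "i = a - 1")
      case False
      then show ?thesis using that by (intro a_col) auto
    qed (simp only: eq_a ca)
    moreover have "1 \<le> a - 1" "a - 1 \<le> s" using a_le \<open>a \<noteq> 1\<close> by auto
    ultimately have "a \<le> a - 1" by (intro a_least conjI ballI)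
    then show False using a_le(1) by simp
  qed
  moreover have "color \<pi> (b + 1) \<noteq> color \<pi> b" if "b \<noteq> n"
  proof
    assume eq_b: "color \<pi> (b + 1) = color \<pi> b"
    have "color \<pi> i = color \<pi> s" if "i \<in> {s..b + 1}" for i
    proof (cases "i = b + 1")
      case False
      then show ?thesis using that by (intro b_col) auto
    qed (simp only: eq_b cb)
    moreover have "b + 1 \<le> n" "s \<le> b + 1" using b_le \<open>b \<noteq> n\<close> by auto
    ultimately have "b + 1 \<le> b" by (intro b_greatest conjI ballI)
    then show False by simp
  qed
  moreover have "color \<pi> i = color \<pi> a" if "i \<in> {a..b}" for i
    unfolding ca using that by (cases "i \<le> s") (auto intro: a_col b_col)
  moreover have "1 \<le> a" "a \<le> b" "b \<le> n" using a_le b_le by auto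
  ultimately have "color_run n \<pi> a b" unfolding color_run_def by blast
  then show thesis by (rule that) (use a_le sb in simp_all)
qed

text \<open>Neighbours of different colors are compared by color alone, and neighbours of equal
  color lie in a common run, whose descents agree. Even the descent sets coincide.\<close>

lemma same_colored_composition_des_eq:
  assumes r: "r \<ge> 1" and eq: "(\<pi>, \<sigma>) \<in> same_colored_composition r n"
  shows "des n \<pi> = des n \<sigma>"
proof -
  have \<pi>: "\<pi> \<in> colored_perms r n" and \<sigma>: "\<sigma> \<in> colored_perms r n"
    and col: "\<And>s. s \<in> {1..n} \<Longrightarrow> color \<pi> s = color \<sigma> s"
    and run: "\<And>a b. color_run n \<pi> a b \<Longrightarrow> run_descents \<pi> a b = run_descents \<sigma> a b"
    using eq by (auto simp: same_colored_composition_def)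
  \<comment> \<open>Every value in the word exceeds the value 0 in position \<open>n + 1\<close>, so
    color 1 at position \<open>n\<close> is already a descent and the color alone decides.\<close>
  have last: "word n \<tau> (n + 1) \<prec> word n \<tau> n \<longleftrightarrow> 1 \<le> color \<tau> n"
    if "\<tau> \<in> colored_perms r n" "n \<in> {1..n}" for \<tau>
    using colored_perms_letter(1)[OF r that]
    by (auto simp: word_def letter_less_def color_def)
  have "word n \<pi> (s + 1) \<prec> word n \<pi> s \<longleftrightarrow> word n \<sigma> (s + 1) \<prec> word n \<sigma> s" if s: "s \<in> {1..n}" for s
  proof (cases "s = n")
    case True
    then show ?thesis using last[OF \<pi>] last[OF \<sigma>] s col by simp
  next
    case False
    then have sn: "1 \<le> s" "s < n" "Suc s \<in> {1..n}" using s by auto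
    show ?thesis
    proof (cases "color \<pi> (Suc s) = color \<pi> s")
      case True
      obtain a b where ab: "color_run n \<pi> a b" "a \<le> s" "s < b"
        using obtain_color_run[OF sn(1,2) True] .
      have "s \<in> run_descents \<pi> a b \<longleftrightarrow> s \<in> run_descents \<sigma> a b" using run[OF ab(1)] by simp
      then show ?thesis using ab(2,3) sn by (simp add: run_descents_def word_def)
    next
      case False
      then show ?thesis
        using col[OF s] col[OF sn(3)] sn by (simp add: word_def letter_less_def color_def)
    qed
  qed
  then have "descents n \<pi> = descents n \<sigma>" by (auto simp: descents_def)
  then show ?thesis by (simp add: des_eq_card_descents)
qed

text \<open>The descent number is constant on equivalence classes, so the colored permutations with
  \<open>i\<close> descents are a disjoint union of classes.\<close>

lemma des_sum_in_mantaci_reutenauer: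
  assumes r: "r \<ge> 1"
  shows "des_sum r n i \<in> mantaci_reutenauer r n"
proof -
  let ?R = "same_colored_composition r n" and ?P = "colored_perms r n"
  let ?Q = "{X \<in> ?P // ?R. \<exists>\<pi>\<in>X. des n \<pi> = i}"
  note equiv = equiv_same_colored_composition[of r n]
  have sub: "X \<subseteq> ?P" if "X \<in> ?P // ?R" for X
    using that Union_quotient[OF equiv] by blast
  have "{\<pi> \<in> ?P. des n \<pi> = i} = \<Union>?Q"
  proof (intro equalityI subsetI)
    fix \<pi> assume \<pi>: "\<pi> \<in> {\<pi> \<in> ?P. des n \<pi> = i}"
    then have "\<pi> \<in> ?R `` {\<pi>}" using equiv_class_self[OF equiv] by blast
    moreover have "?R `` {\<pi>} \<in> ?P // ?R" using \<pi> by (intro quotientI) simp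
    ultimately show "\<pi> \<in> \<Union>?Q" using \<pi> by blast
  next
    fix \<pi> assume "\<pi> \<in> \<Union>?Q"
    then obtain X \<sigma> where X: "X \<in> ?P // ?R" "\<pi> \<in> X" "\<sigma> \<in> X" "des n \<sigma> = i" by blast
    then have "(\<pi>, \<sigma>) \<in> ?R" using quotient_eq_iff[OF equiv X(1) X(1)] by blast
    then have "des n \<pi> = i" using same_colored_composition_des_eq[OF r] X(4) by simp
    then show "\<pi> \<in> {\<pi> \<in> ?P. des n \<pi> = i}" using sub X by blast
  qed
  then have "des_sum r n i = ga_sum (\<Union>?Q)" by (simp add: des_sum_def)
  also have "\<dots> = (\<Sum>X\<in>?Q. ga_sum X)"
  proof (rule ga_sum_Union_disjoint)
    show "finite X" if "X \<in> ?Q" for X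
      using that sub finite_subset[OF _ finite_colored_perms] by blast
    show "disjoint ?Q"
      using quotient_disj[OF equiv] by (auto simp: disjoint_def)
  qed
  also have "\<dots> \<in> mantaci_reutenauer r n"
    unfolding mantaci_reutenauer_def by (intro QG.span_sum QG.span_base) auto
  finally show ?thesis .
qed

theorem mainTheorem10:
  fixes r n :: nat
  assumes "r \<ge> 1" and "n \<ge> 1"
  shows "\<exists>A. ga_subalgebra (colored_perm_group r n) A \<and>
    inj_on (des_sum r n) {i \<in> {0..n}. des_sum r n i \<noteq> 0} \<and>
    QG.independent (des_sum r n ` {i \<in> {0..n}. des_sum r n i \<noteq> 0}) \<and>
    QG.span (des_sum r n ` {i \<in> {0..n}. des_sum r n i \<noteq> 0}) = A \<and>
    A \<subseteq> mantaci_reutenauer r n"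
proof -
  let ?I = "{i \<in> {0..n}. des_sum r n i \<noteq> 0}"
  let ?S = "\<lambda>i. {\<pi> \<in> colored_perms r n. des n \<pi> = i}"
  have S: "finite (?S i) \<and> ?S i \<noteq> {}" if "i \<in> ?I" for i
  proof -
    have "?S i \<noteq> {}"
    proof
      assume "?S i = {}"
      then have "des_sum r n i = 0" by (simp only: des_sum_def ga_sum_def sum.empty)
      then show False using that by simp
    qed
    then show ?thesis using finite_des_class by blast
  qed
  have disj: "disjoint_family_on ?S ?I" by (auto simp: disjoint_family_on_def)
  have des_sum: "des_sum r n = (\<lambda>i. ga_sum (?S i))" by (simp add: des_sum_def[abs_def])
  have "inj_on (des_sum r n) ?I"
    unfolding des_sum by (rule inj_on_ga_sum_disjoint) (use S disj in \<open>simp_all add: des_sum\<close>)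
  moreover have "QG.independent (des_sum r n ` ?I)"
    unfolding des_sum by (rule independent_ga_sum_disjoint) (use S disj in \<open>simp_all add: des_sum\<close>)
  \<comment> \<open>Closure under products is transferred from the standardization sums, which have
    the same span.\<close>
  moreover have "ga_subalgebra (colored_perm_group r n) (QG.span (des_sum r n ` ?I))"
    unfolding span_des_sum_eq[OF assms] by (rule ga_subalgebra_span_std_sum[OF assms(1)])
  moreover have "QG.span (des_sum r n ` ?I) \<subseteq> mantaci_reutenauer r n"
    using des_sum_in_mantaci_reutenauer[OF assms(1)]
    unfolding mantaci_reutenauer_def by (intro QG.span_minimal QG.subspace_span) auto
  ultimately show ?thesis by blast
qed

end
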